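(* As $n\to\infty$, $$k_0(n,2,2)\le (1+o(1))\lg n .$$
   Context: $\lg$ denotes $\log_2$. For a positive integer $t$, $[t]=\{1,\dots,t\}$. A word $w=w_1\cdots w_t$ of length $t$ over an alphabet induces the partition of $[t]$ in which $i$ and $j$ are in the same block iff $w_i=w_j$; two words are equivalent if they induce the same partition. For $n\ge t$, a $k\times n$ array with entries from the alphabet $\{1,\dots,d\}$ (or any $d$-letter alphabet) is a covering array for set partitions (with parameters $t,d$) if for each choice of $t$ columns, each of the $B(t)$ partitions of $[t]$ (into any number of parts, $B(t)$ being the Bell number) is induced by the word appearing in at least one of the rows of the selected $t$ columns (the columns being taken in their order from left to right). $k_0(n,t,d)$ denotes the minimum number $k$ of rows for which such a $k\times n$ array exists. The term $o(1)$ denotes a quantity tending to $0$ as $n\to\infty$. *)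

theory Defs
  imports Complex_Main "HOL-Library.Disjoint_Sets" "HOL-Library.FuncSet"
    "HOL-Library.Landau_Symbols"
begin

text \<open>Words of length \<open>t\<close> and \<open>k \<times> n\<close> arrays are functions of 1-based indices; only their
  values on \<open>{1..t}\<close>, respectively \<open>{1..k} \<times> {1..n}\<close>, matter.\<close>

definition induced_partition :: "nat \<Rightarrow> (nat \<Rightarrow> nat) \<Rightarrow> nat set set" where
  "induced_partition t w = {1..t} // {(i, j). i \<in> {1..t} \<and> j \<in> {1..t} \<and> w i = w j}"

text \<open>The map \<open>c\<close> lists the selected columns from left to right: the \<open>s\<close>-th selected column is
  \<open>c s\<close>. The condition is meant for \<open>1 \<le> t \<le> n\<close>.\<close>

definition partition_covering_array ::
    "nat \<Rightarrow> nat \<Rightarrow> nat \<Rightarrow> nat \<Rightarrow> (nat \<Rightarrow> nat \<Rightarrow> nat) \<Rightarrow> bool" where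
  "partition_covering_array k n t d A \<longleftrightarrow>
     (\<forall>i\<in>{1..k}. \<forall>j\<in>{1..n}. A i j \<in> {1..d}) \<and>
     (\<forall>c. strict_mono_on {1..t} c \<and> c ` {1..t} \<subseteq> {1..n} \<longrightarrow>
        (\<forall>P. partition_on {1..t} P \<longrightarrow>
           (\<exists>i\<in>{1..k}. induced_partition t (\<lambda>s. A i (c s)) = P)))"

definition k0 :: "nat \<Rightarrow> nat \<Rightarrow> nat \<Rightarrow> nat" where
  "k0 n t d = (LEAST k. \<exists>A. partition_covering_array k n t d A)"

text \<open>The minimum defining \<open>k0\<close> is attained whenever the alphabet has at least \<open>t\<close> letters:
  the array whose rows are all words of length \<open>n\<close> is covering.\<close>

lemma partition_covering_array_exists:
  assumes "1 \<le> t" "t \<le> d"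
  shows "\<exists>k A. partition_covering_array k n t d A"
proof -
  define F where "F = {1..n} \<rightarrow>\<^sub>E {1..d}"
  have "finite F" by (auto simp: F_def intro: finite_PiE)
  then obtain h where h: "bij_betw h {1..card F} F"
    using ex_bij_betw_nat_finite_1 by blast
  have row: "\<exists>i\<in>{1..card F}. induced_partition t (\<lambda>s. h i (c s)) = P"
    if c: "strict_mono_on {1..t} c" "c ` {1..t} \<subseteq> {1..n}" and P: "partition_on {1..t} P" for c P
  proof -
    define r where "r = {(x, y). \<exists>p\<in>P. x \<in> p \<and> y \<in> p}"
    have eq: "equiv {1..t} r" and quo: "{1..t} // r = P"
      using equiv_partition_on[OF P] partition_on_eq_quotient[OF P] by (auto simp: r_def)
    define f where "f s = Min (r `` {s})" for s
    have cls: "r `` {s} \<subseteq> {1..t}" "s \<in> r `` {s}" if "s \<in> {1..t}" for s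
      using eq that by (auto simp: equiv_def refl_on_def)
    have fin: "f s \<in> r `` {s}" if "s \<in> {1..t}" for s
      unfolding f_def using cls[OF that] finite_subset[OF cls(1)[OF that]]
      by (intro Min_in) auto
    have f_iff: "f x = f y \<longleftrightarrow> (x, y) \<in> r" if "x \<in> {1..t}" "y \<in> {1..t}" for x y
    proof
      assume "f x = f y"
      then have "(x, f x) \<in> r" "(y, f x) \<in> r" using fin that by force+
      then show "(x, y) \<in> r" using eq by (meson equivE symD transD)
    next
      assume "(x, y) \<in> r"
      then show "f x = f y" unfolding f_def using eq by (metis equiv_class_eq)
    qed
    have inj: "inj_on c {1..t}" using c(1) by (rule strict_mono_on_imp_inj_on)
    define w where "w = restrict (\<lambda>j. if j \<in> c ` {1..t} then f (inv_into {1..t} c j) else 1) {1..n}"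
    have "f s \<in> {1..d}" if "s \<in> {1..t}" for s
      using fin[OF that] cls(1)[OF that] assms by fastforce
    then have "w \<in> F"
      unfolding F_def w_def using assms inj by (auto simp: inv_into_f_f)
    then obtain i where i: "i \<in> {1..card F}" "h i = w"
      using h by (metis bij_betw_iff_bijections)
    have w: "w (c s) = f s" if "s \<in> {1..t}" for s
    proof -
      have "c s \<in> {1..n}" using c(2) that by blast
      then show ?thesis using that inj by (simp add: w_def inv_into_f_f)
    qed
    have "{(x, y). x \<in> {1..t} \<and> y \<in> {1..t} \<and> w (c x) = w (c y)} = r"
      using w f_iff equiv_type[OF eq] by auto
    then show ?thesis using i quo by (auto simp: induced_partition_def)
  qed
  have "h i j \<in> {1..d}" if "i \<in> {1..card F}" "j \<in> {1..n}" for i j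
    using h that unfolding F_def bij_betw_def by (metis PiE_mem imageI)
  with row have "partition_covering_array (card F) n t d h"
    unfolding partition_covering_array_def by blast
  then show ?thesis by blast
qed

end

theory Submission
  imports Defs
begin

text \<open>
  A set of two positions has only two partitions: the one that joins the positions and the one that
  separates them. Over a two-letter alphabet an array is therefore covering for \<open>t = 2\<close> iff no two
  of its columns are equal and no two are complementary. Distinct columns that all agree in one
  common row satisfy both demands, so \<open>m + 1\<close> rows suffice as soon as there are \<open>n\<close> distinct binary
  vectors of length \<open>m\<close>, that is, as soon as \<open>n \<le> 2 ^ m\<close>; see \<open>k0_2_2_le\<close>. Choosing
  \<open>m = \<lceil>log 2 n\<rceil>\<close> costs at most \<open>2\<close> rows more than \<open>log 2 n\<close>, which is a relative
  error of \<open>2 / log 2 n\<close> and tends to \<open>0\<close>.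
\<close>

text \<open>An equivalence relation on two points is determined by whether it relates them.\<close>

lemma induced_partition_2_eq:
  assumes P: "partition_on {1..2::nat} P"
    and w: "w 1 = w 2 \<longleftrightarrow> (\<exists>p\<in>P. 1 \<in> p \<and> 2 \<in> p)"
  shows "induced_partition 2 w = P"
proof -
  define r where "r = {(x, y). \<exists>p\<in>P. x \<in> p \<and> y \<in> p}"
  have eq: "equiv {1..2} r" and quo: "{1..2} // r = P"
    using equiv_partition_on[OF P] partition_on_eq_quotient[OF P] by (auto simp: r_def)
  have mem: "x \<in> {1..2} \<longleftrightarrow> x = 1 \<or> x = 2" for x :: nat
    unfolding atLeastAtMost_iff by arith
  have r12: "(1, 2) \<in> r \<longleftrightarrow> w 1 = w 2" "(2, 1) \<in> r \<longleftrightarrow> w 1 = w 2"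
    unfolding r_def w by blast+
  have refl: "(1, 1) \<in> r" "(2, 2) \<in> r"
    using eq mem unfolding equiv_def refl_on_def by blast+
  have dom: "i \<in> {1..2} \<and> j \<in> {1..2}" if "(i, j) \<in> r" for i j
    using subsetD[OF equiv_type[OF eq] that] by (simp only: mem_Sigma_iff)
  have "(i, j) \<in> {(i, j). i \<in> {1..2} \<and> j \<in> {1..2} \<and> w i = w j} \<longleftrightarrow> (i, j) \<in> r" for i j
  proof (cases "i \<in> {1..2} \<and> j \<in> {1..2}")
    case True
    then consider "i = 1" "j = 1" | "i = 1" "j = 2" | "i = 2" "j = 1" | "i = 2" "j = 2"
      unfolding mem by blast
    then show ?thesis using r12 refl by cases (simp_all add: eq_commute)
  next
    case False
    then have "(i, j) \<notin> r" using dom by blast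
    with False show ?thesis by (auto simp del: atLeastAtMost_iff)
  qed
  then have "{(i, j). i \<in> {1..2} \<and> j \<in> {1..2} \<and> w i = w j} = r"
    by (intro subset_antisym subrelI) (simp_all only:)
  then show ?thesis
    by (simp only: induced_partition_def quo)
qed

lemma distinct_nats_differ_in_low_bit:
  fixes a b :: nat
  assumes "a < 2 ^ m" "b < 2 ^ m" "a \<noteq> b"
  shows "\<exists>i<m. bit a i \<noteq> bit b i"
proof (rule ccontr)
  assume "\<not> ?thesis"
  then have "take_bit m a = take_bit m b"
    by (intro bit_eqI) (auto simp: bit_take_bit_iff)
  then show False using assms by (simp add: take_bit_nat_eq_self)
qed

text \<open>Column \<open>j\<close> of the array is the binary expansion of \<open>j - 1\<close>. The numbers \<open>0, \<dots>, n - 1\<close> need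
  only \<open>m\<close> bits, so the additional bit in row \<open>m + 1\<close> vanishes in every column and makes every pair
  of columns agree there.\<close>

lemma k0_2_2_le:
  assumes n: "n \<le> 2 ^ m"
  shows "k0 n 2 2 \<le> m + 1"
proof -
  \<comment> \<open>The outer \<open>1 +\<close> turns the bits \<open>0, 1\<close> into the letters \<open>1, 2\<close>.\<close>
  define A :: "nat \<Rightarrow> nat \<Rightarrow> nat" where "A i j = 1 + of_bool (bit (j - 1) (i - 1))" for i j
  have row: "\<exists>i\<in>{1..m+1}. induced_partition 2 (\<lambda>s. A i (c s)) = P"
    if c: "strict_mono_on {1..2} c" "c ` {1..2} \<subseteq> {1..n}" and P: "partition_on {1..2} P"
    for c :: "nat \<Rightarrow> nat" and P
  proof -
    have "c 1 < c 2" using c(1) by (auto simp: strict_mono_on_def)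
    moreover have "c 1 \<in> {1..n}" "c 2 \<in> {1..n}"
      by (rule subsetD[OF c(2) imageI]; simp)+
    ultimately have lt: "c 1 - 1 < 2 ^ m" "c 2 - 1 < 2 ^ m" and ne: "c 1 - 1 \<noteq> c 2 - 1"
      using n by auto
    have "\<exists>i\<in>{1..m+1}. A i (c 1) = A i (c 2) \<longleftrightarrow> (\<exists>p\<in>P. 1 \<in> p \<and> 2 \<in> p)"
    proof (cases "\<exists>p\<in>P. 1 \<in> p \<and> 2 \<in> p")
      case True
      have "A (m + 1) (c 1) = A (m + 1) (c 2)"
        using lt by (simp add: A_def bit_iff_odd)
      with True show ?thesis by (intro bexI[of _ "m + 1"]) auto
    next
      case False
      obtain i where "i < m" "bit (c 1 - 1) i \<noteq> bit (c 2 - 1) i"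
        using distinct_nats_differ_in_low_bit[OF lt ne] by blast
      with False show ?thesis by (intro bexI[of _ "i + 1"]) (auto simp: A_def)
    qed
    then obtain i where "i \<in> {1..m+1}" "A i (c 1) = A i (c 2) \<longleftrightarrow> (\<exists>p\<in>P. 1 \<in> p \<and> 2 \<in> p)"
      by (rule bexE)
    then show ?thesis
      by (intro bexI[of _ i] induced_partition_2_eq[OF P])
  qed
  have "A i j \<in> {1..2}" for i j by (simp add: A_def)
  with row have "partition_covering_array (m + 1) n 2 2 A"
    unfolding partition_covering_array_def by blast
  then show ?thesis
    unfolding k0_def by (blast intro: Least_le)
qed

lemma k0_2_2_le_log:
  assumes "1 \<le> n"
  shows "real (k0 n 2 2) \<le> log 2 (real n) + 2"
proof -
  define m where "m = nat \<lceil>log 2 (real n)\<rceil>"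
  have nonneg: "0 \<le> log 2 (real n)" using assms by simp
  have "log 2 (real n) \<le> real m" unfolding m_def by linarith
  then have "real n \<le> 2 ^ m"
    using assms by (simp add: log_le_iff powr_realpow)
  then have "n \<le> 2 ^ m" by (metis of_nat_le_iff of_nat_numeral of_nat_power)
  then have "real (k0 n 2 2) \<le> real m + 1"
    using k0_2_2_le[of n m] by linarith
  moreover have "real m \<le> log 2 (real n) + 1"
    unfolding m_def using nonneg by linarith
  ultimately show ?thesis by linarith
qed

theorem theorem2p3:
  "\<exists>\<epsilon> :: nat \<Rightarrow> real. \<epsilon> \<in> o(\<lambda>_. 1) \<and>
     (\<forall>\<^sub>F n in sequentially. real (k0 n 2 2) \<le> (1 + \<epsilon> n) * log 2 (real n))"
proof (intro exI conjI)
  show "(\<lambda>n. 2 / log 2 (real n)) \<in> o(\<lambda>_. 1)"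
  proof (rule smalloI_tendsto)
    have "filterlim (\<lambda>n. inverse (ln 2) * ln (real n)) at_top sequentially"
      by (intro filterlim_tendsto_pos_mult_at_top[OF tendsto_const]
          filterlim_compose[OF ln_at_top filterlim_real_sequentially]) simp
    then have "filterlim (\<lambda>n. log 2 (real n)) at_infinity sequentially"
      by (auto simp: log_def field_simps dest: filterlim_at_top_imp_at_infinity)
    then show "(\<lambda>n. 2 / log 2 (real n) / 1) \<longlonglongrightarrow> 0"
      using tendsto_divide_0[OF tendsto_const, of _ sequentially 2] by simp
  qed auto
  show "\<forall>\<^sub>F n in sequentially. real (k0 n 2 2) \<le> (1 + 2 / log 2 (real n)) * log 2 (real n)"
    using eventually_ge_at_top[of 2]
  proof eventually_elim
    case (elim n)
    then have "log 2 (real n) > 0" by simp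
    then have "(1 + 2 / log 2 (real n)) * log 2 (real n) = log 2 (real n) + 2"
      by (simp add: field_simps)
    with k0_2_2_le_log[of n] elim show ?case by simp
  qed
qed

end
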